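(* Let $G=Sym(\mathbb{N})$ and let $H=K\rtimes\langle \hat f\rangle\leq G$ be the subgroup described in the context. For every $k\in\mathbb{N}$ there is at least one $k'>k$ such that $E_{k'+1}(H)$ is a proper subgroup of $E_{k+1}(H)$.
   Context: $\mathbb{N}=\{0,1,2,\dots\}$; permutations act on the left. Commutators are $[g,h]=g^{-1}h^{-1}gh$, and for an element $g$ and a subset $S$ of a group, $[g,S]=\{[g,s]\mid s\in S\}$. Iterated centralizers: for a group $G$ and a subset $A\subseteq G$, set $C_G^0(A)=1$ and for $k\geq 1$ $$C_G^k(A)=\Big\{x\in\bigcap_{n<k}N_G\big(C_G^n(A)\big)\;\Big|\;[x,A]\subseteq C_G^{k-1}(A)\Big\},$$ where $N_G$ denotes the normalizer in $G$. These are subgroups of $G$. Envelopes: for a group $G$ and a subgroup $H\leq G$, set $E_0(H)=G$ and for $k\geq 0$ $$E_{k+1}(H)=\Big\{g\in E_k(H)\;\Big|\;\big[g,C_{E_k(H)}^{k+1}(H)\big]\subseteq C_{E_k(H)}^{k}(H)\Big\},$$ where the iterated centralizers are computed in the group $E_k(H)$. These form a descending chain of subgroups $G=E_0(H)\geq E_1(H)\geq\cdots\geq H$. The subgroup $H$: let $G=Sym(\mathbb{N})$ be the group of all permutations of $\mathbb{N}$, and let $K=\bigoplus_{x\in\mathbb{N}}\langle(2x\ \ 2x+1)\rangle\leq G$ be the subgroup generated by the transpositions $(2x\ \ 2x+1)$, $x\in\mathbb{N}$. Let $f:\mathbb{N}\to\mathbb{N}$ be the bijection with $f(x)=x+2$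 if $x$ is even, $f(x)=x-2$ if $x$ is odd and $x\neq 1$, and $f(1)=0$. Let $\hat f\in G$ be the permutation $2x\mapsto 2f(x)$, $2x+1\mapsto 2f(x)+1$ ($x\in\mathbb{N}$); conjugation by $\hat f$ sends $(2x\ \ 2x+1)$ to $(2f(x)\ \ 2f(x)+1)$. Then $H=K\rtimes\langle\hat f\rangle$ is the subgroup of $G$ generated by $K$ and $\hat f$. *)

theory Defs
  imports
    "HOL-Algebra.Bij"
    "HOL-Algebra.Generated_Groups"
    "HOL-Algebra.Group_Action"
    "HOL-Combinatorics.Transposition"
begin

definition commutator :: "('a, 'b) monoid_scheme \<Rightarrow> 'a \<Rightarrow> 'a \<Rightarrow> 'a" where
  "commutator G g h = inv\<^bsub>G\<^esub> g \<otimes>\<^bsub>G\<^esub> inv\<^bsub>G\<^esub> h \<otimes>\<^bsub>G\<^esub> g \<otimes>\<^bsub>G\<^esub> h"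

text \<open>The set \<open>[g, S]\<close> of commutators; it is not closed up to a subgroup.\<close>

definition commutator_set :: "('a, 'b) monoid_scheme \<Rightarrow> 'a \<Rightarrow> 'a set \<Rightarrow> 'a set" where
  "commutator_set G g S = {commutator G g s | s. s \<in> S}"

text \<open>
  \<open>iterated_centralizer G A k\<close> is \<open>C\<^sub>G\<^sup>k(A)\<close>. The index set \<open>{..k}\<close> in the equation for \<open>Suc k\<close>
  is \<open>{n. n < Suc k}\<close>.
\<close>

fun iterated_centralizer :: "('a, 'b) monoid_scheme \<Rightarrow> 'a set \<Rightarrow> nat \<Rightarrow> 'a set" where
  "iterated_centralizer G A 0 = {\<one>\<^bsub>G\<^esub>}"
| "iterated_centralizer G A (Suc k) =
     {x \<in> (\<Inter>n\<in>{..k}. normalizer G (iterated_centralizer G A n)).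
        commutator_set G x A \<subseteq> iterated_centralizer G A k}"

text \<open>
  \<open>envelope G H k\<close> is \<open>E\<^sub>k(H)\<close>. The iterated centralizers, and hence the normalizers in them, are
  taken in the subgroup \<open>E\<^sub>k(H)\<close>, not in \<open>G\<close>.
\<close>

fun envelope :: "('a, 'b) monoid_scheme \<Rightarrow> 'a set \<Rightarrow> nat \<Rightarrow> 'a set" where
  "envelope G H 0 = carrier G"
| "envelope G H (Suc k) =
     {g \<in> envelope G H k.
        commutator_set G g (iterated_centralizer (G\<lparr>carrier := envelope G H k\<rparr>) H (Suc k))
          \<subseteq> iterated_centralizer (G\<lparr>carrier := envelope G H k\<rparr>) H k}"

text \<open>
  \<open>Sym(\<nat>)\<close>. Over \<open>UNIV\<close> the extensionality condition in \<^const>\<open>Bij\<close> is void, and the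
  product is composition of functions, i.e. permutations act on the left.
\<close>

abbreviation SymN :: "(nat \<Rightarrow> nat) monoid" where
  "SymN \<equiv> BijGroup (UNIV :: nat set)"

definition K_sub :: "(nat \<Rightarrow> nat) set" where
  "K_sub = generate SymN {Transposition.transpose (2 * x) (2 * x + 1) | x. True}"

definition shift :: "nat \<Rightarrow> nat" where
  "shift x = (if even x then x + 2 else if x = 1 then 0 else x - 2)"

definition shift_hat :: "nat \<Rightarrow> nat" where
  "shift_hat n = (if even n then 2 * shift (n div 2) else 2 * shift (n div 2) + 1)"

definition H_sub :: "(nat \<Rightarrow> nat) set" where
  "H_sub = generate SymN (K_sub \<union> {shift_hat})"

lemma carrier_SymN: "carrier SymN = {p. bij p}"
  by (simp add: BijGroup_def Bij_def)

lemma mult_SymN: "bij p \<Longrightarrow> bij q \<Longrightarrow> p \<otimes>\<^bsub>SymN\<^esub> q = p \<circ> q"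
  by (auto simp: BijGroup_def Bij_def compose_def fun_eq_iff)

lemma shift_hat_double: "shift_hat (2 * x) = 2 * shift x" "shift_hat (2 * x + 1) = 2 * shift x + 1"
  by (simp_all add: shift_hat_def)

lemma bij_shift: "bij shift"
proof -
  define h :: "nat \<Rightarrow> nat"
    where "h x = (if odd x then x + 2 else if x = 0 then 1 else x - 2)" for x
  have "h (shift x) = x" for x
    unfolding shift_def h_def by presburger
  moreover have "shift (h x) = x" for x
    unfolding shift_def h_def by presburger
  ultimately show ?thesis
    by (intro bij_betw_byWitness[where f' = h]) auto
qed

lemma bij_shift_hat: "bij shift_hat"
proof -
  define h where "h n = 2 * inv_into UNIV shift (n div 2) + n mod 2" for n :: nat
  have 1: "shift_hat n = 2 * shift (n div 2) + n mod 2" for n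
    by (simp add: shift_hat_def) presburger
  have "inv_into UNIV shift (shift x) = x" "shift (inv_into UNIV shift x) = x" for x
    using bij_shift by (simp_all add: bij_is_inj bij_is_surj surj_f_inv_f)
  then have "h (shift_hat n) = n" "shift_hat (h n) = n" for n
    by (simp_all add: h_def 1)
  then show ?thesis
    by (intro bij_betw_byWitness[where f' = h]) auto
qed

lemma shift_hat_conj_transpose:
  "shift_hat \<circ> Transposition.transpose (2 * x) (2 * x + 1) =
   Transposition.transpose (2 * shift x) (2 * shift x + 1) \<circ> shift_hat"
proof -
  have "shift_hat (Transposition.transpose a b c) =
        Transposition.transpose (shift_hat a) (shift_hat b) (shift_hat c)" for a b c
    using bij_is_inj[OF bij_shift_hat] by (auto simp: Transposition.transpose_def inj_eq)
  then show ?thesis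
    using shift_hat_double by (simp only: fun_eq_iff comp_def) simp
qed

end

theory Submission
  imports Defs
begin

text \<open>
  The pairs \<open>{2x, 2x + 1}\<close> are the cells of a partition of \<open>\<nat>\<close>. The bijection \<open>shift\<close> has a
  single infinite orbit, so the cells can be numbered by the integers in such a way that
  \<open>shift_hat\<close> moves each cell to the next one. A function \<open>u\<close> from the integers to the field with
  two elements gives the permutation \<open>swap u\<close> that exchanges the two points of every cell \<open>i\<close>
  with \<open>u i\<close>. These permutations form an abelian group \<open>P\<close>. A permutation \<open>g\<close> that moves
  the cells by \<open>\<sigma>\<close> has the commutator \<open>[g, swap u] = swap (u + u \<circ> \<sigma>)\<close> with \<open>swap u\<close>; for
  \<open>shift_hat\<close> it is given by the difference operator \<open>D\<close> with \<open>(D u) i = u i + u (i + 1)\<close>.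

  Every \<open>C\<^sup>k(H)\<close> is therefore \<open>L\<^sub>k = {swap u | D\<^sup>k u = 0}\<close>, in every ambient group that
  contains \<open>P\<close> and \<open>shift_hat\<close> (\<open>iterated_centralizer_eq\<close>). The point is that an \<open>x\<close> in
  \<open>C\<^sup>k(H)\<close> must lie in \<open>P\<close>: its commutator with a single transposition has finite support, and
  \<open>D\<close> is injective on functions of finite support, so this commutator, being in \<open>L\<^sub>k\<^sub>-\<^sub>1\<close>, is
  trivial; a permutation that commutes with all the transpositions preserves each cell. Since \<open>P\<close> is
  abelian and \<open>shift_hat\<close> lowers the \<open>L\<^sub>k\<close>, both survive in all envelopes, and \<open>E\<^sub>k(H)\<close> consists
  of the permutations \<open>g\<close> with \<open>[g, L\<^sub>j\<^sub>+\<^sub>1] \<subseteq> L\<^sub>j\<close> for all \<open>j < k\<close> (\<open>envelope_Suc\<close>).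

  In characteristic two, \<open>(D\<^sup>q u) i = u i + u (i + q)\<close> for \<open>q = 2\<^sup>m\<close>. So the functions occurring
  in \<open>L\<^sub>k\<close> with \<open>k \<le> q\<close> are \<open>q\<close>-periodic, and a permutation \<open>g\<close> that exchanges
  the cells \<open>0\<close> and \<open>q\<close> commutes with all of \<open>L\<^sub>k\<close>; hence it is in \<open>E\<^sub>q(H)\<close>. On the other hand
  the indicator function \<open>u\<close> of the multiples of \<open>2q\<close> occurs in \<open>L\<^sub>2\<^sub>q\<close>, and \<open>[g, swap u]\<close> is
  supported on exactly the cells \<open>0\<close> and \<open>q\<close>, so it is in no \<open>L\<^sub>j\<close>. Therefore \<open>g\<close> is not in
  \<open>E\<^sub>2\<^sub>q(H)\<close>, and \<open>q\<close> can be taken as large as desired.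
\<close>

section \<open>Commutators and normalizers in subgroups\<close>

text \<open>
  Commutators of permutations are computed in this form, which mentions no inverses.
\<close>

lemma (in group) commutator_eq_iff:
  assumes "g \<in> carrier G" "h \<in> carrier G" "z \<in> carrier G"
  shows "commutator G g h = z \<longleftrightarrow> g \<otimes> h = h \<otimes> g \<otimes> z"
proof -
  have "commutator G g h = inv (h \<otimes> g) \<otimes> (g \<otimes> h)"
    using assms by (simp add: commutator_def inv_mult_group m_assoc)
  then show ?thesis
    using assms by (metis inv_solve_left' m_closed)
qed

lemma (in group) commutator_subgroup:
  assumes "subgroup E G" "g \<in> E" "h \<in> E"
  shows "commutator (G\<lparr>carrier := E\<rparr>) g h = commutator G g h"
  using assms by (simp add: commutator_def m_inv_consistent)

lemma (in group) mult_inv_cancel_left: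
  assumes "x \<in> carrier G" "y \<in> carrier G"
  shows "x \<otimes> (inv x \<otimes> y) = y" "inv x \<otimes> (x \<otimes> y) = y"
  using assms by (simp_all add: m_assoc [symmetric])

lemma (in group) commutator_mult_left:
  assumes "g \<in> carrier G" "h \<in> carrier G" "x \<in> carrier G"
  shows "commutator G (g \<otimes> h) x = (inv h \<otimes> commutator G g x \<otimes> h) \<otimes> commutator G h x"
  using assms by (simp add: commutator_def inv_mult_group m_assoc mult_inv_cancel_left)

lemma (in group) commutator_inv_left:
  assumes "g \<in> carrier G" "x \<in> carrier G"
  shows "commutator G (inv g) x = g \<otimes> inv (commutator G g x) \<otimes> inv g"
  using assms by (simp add: commutator_def inv_mult_group m_assoc)

lemma (in group) conjugate_eq_commutator:
  assumes "g \<in> carrier G" "x \<in> carrier G"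
  shows "inv g \<otimes> x \<otimes> g = x \<otimes> inv (commutator G g x)"
  using assms by (simp add: commutator_def inv_mult_group m_assoc mult_inv_cancel_left)

lemma (in group) commuting_in_normalizer:
  assumes "S \<subseteq> carrier G" "x \<in> carrier G" "\<And>s. s \<in> S \<Longrightarrow> x \<otimes> s = s \<otimes> x"
  shows "x \<in> normalizer G S"
proof -
  have "x \<otimes> s \<otimes> inv x = s" if "s \<in> S" for s
    using assms that by (metis inv_solve_right' subsetD m_closed)
  then have "x <# S #> inv x = S"
    by (force simp: l_coset_def r_coset_def)
  with assms show ?thesis
    by (simp add: normalizer_def stabilizer_def)
qed

lemma normalizer_subset: "normalizer G S \<subseteq> carrier G"
  by (auto simp: normalizer_def stabilizer_def)

interpretation SymN: group SymN
  by (rule group_BijGroup)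

section \<open>Cells and the permutations exchanging their points\<close>

text \<open>
  The number of the pair \<open>{2x, 2x + 1}\<close> on the orbit \<open>\<dots>, 5, 3, 1, 0, 2, 4, \<dots>\<close> of \<open>shift\<close>, counted
  from \<open>0\<close>.
\<close>

definition pair_index :: "nat \<Rightarrow> int" where
  "pair_index x = (if even x then int (x div 2) else - int (Suc x div 2))"

definition cell :: "nat \<Rightarrow> int" where
  "cell n = pair_index (n div 2)"

definition partner :: "nat \<Rightarrow> nat" where
  "partner n = (if even n then n + 1 else n - 1)"

definition swap :: "(int \<Rightarrow> bool) \<Rightarrow> nat \<Rightarrow> nat" where
  "swap u n = (if u (cell n) then partner n else n)"

lemma pair_index_shift: "pair_index (shift x) = pair_index x + 1"
proof -
  consider y where "x = 2 * y" | "x = 1" | y where "x = 2 * y + 3"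
    by (metis One_nat_def evenE oddE add.commute add_2_eq_Suc' add_Suc_right mult_Suc_right not0_implies_Suc numeral_3_eq_3 plus_1_eq_Suc mult_0_right)
  then show ?thesis
    by cases (simp_all add: pair_index_def shift_def)
qed

lemma inj_pair_index: "inj pair_index"
proof (rule injI)
  fix x y
  assume "pair_index x = pair_index y"
  then show "x = y"
    by (cases "even x"; cases "even y") (auto simp: pair_index_def elim!: evenE oddE)
qed

lemma pair_index_surj: "\<exists>x. pair_index x = i"
proof (cases "i \<ge> 0")
  case True
  then have "pair_index (2 * nat i) = i" by (simp add: pair_index_def)
  then show ?thesis by blast
next
  case False
  then have "pair_index (2 * nat (- i - 1) + 1) = i" by (simp add: pair_index_def)
  then show ?thesis by blast
qed

lemma cell_surj: "\<exists>n. cell n = i"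
proof -
  obtain x where "pair_index x = i" using pair_index_surj by blast
  then have "cell (2 * x) = i" by (simp add: cell_def)
  then show ?thesis by blast
qed

lemma cell_shift_hat: "cell (shift_hat n) = cell n + 1"
  by (simp add: cell_def shift_hat_def pair_index_shift)

lemma partner_neq: "partner n \<noteq> n"
  by (auto simp: partner_def elim: oddE)

lemma partner_partner [simp]: "partner (partner n) = n"
  by (auto simp: partner_def)

lemma cell_eq_iff: "cell n = cell m \<longleftrightarrow> n = m \<or> n = partner m"
proof -
  have "cell n = cell m \<longleftrightarrow> n div 2 = m div 2"
    by (simp add: cell_def inj_eq[OF inj_pair_index])
  also have "\<dots> \<longleftrightarrow> n = m \<or> n = partner m"
    by (cases "even n"; cases "even m") (auto simp: partner_def elim!: evenE oddE)
  finally show ?thesis .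
qed

lemma cell_partner [simp]: "cell (partner n) = cell n"
  by (simp add: cell_eq_iff)

lemma cell_swap [simp]: "cell (swap u n) = cell n"
  by (simp add: swap_def)

lemma swap_swap: "swap u \<circ> swap v = swap (\<lambda>i. u i \<noteq> v i)"
  by (auto simp: swap_def fun_eq_iff)

lemma swap_False: "swap (\<lambda>_. False) = id"
  by (auto simp: swap_def fun_eq_iff)

lemma swap_eq_iff: "swap u = swap v \<longleftrightarrow> u = v"
proof
  assume eq: "swap u = swap v"
  show "u = v"
  proof
    fix i
    obtain n where "cell n = i" using cell_surj by blast
    with fun_cong[OF eq, of n] show "u i = v i"
      using partner_neq[of n] by (auto simp: swap_def split: if_splits)
  qed
qed simp

lemma bij_swap: "bij (swap u)"
  by (rule o_bij[of "swap u"]) (simp_all add: swap_swap swap_False)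

lemma swap_in_SymN [simp]: "swap u \<in> carrier SymN"
  by (simp add: carrier_SymN bij_swap)

lemma mult_swap [simp]: "swap u \<otimes>\<^bsub>SymN\<^esub> swap v = swap (\<lambda>i. u i \<noteq> v i)"
  by (simp add: mult_SymN bij_swap swap_swap)

lemma one_SymN: "\<one>\<^bsub>SymN\<^esub> = swap (\<lambda>_. False)"
  by (simp add: BijGroup_def swap_False id_def restrict_def)

lemma inv_swap [simp]: "inv\<^bsub>SymN\<^esub> swap u = swap u"
  by (rule SymN.inv_equality) (simp_all add: one_SymN)

lemma transpose_eq_swap:
  "Transposition.transpose (2 * x) (2 * x + 1) = swap (\<lambda>i. i = pair_index x)"
proof
  fix n
  have "cell n = pair_index x \<longleftrightarrow> n = 2 * x \<or> n = 2 * x + 1"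
    using cell_eq_iff[of n "2 * x"] by (simp add: cell_def partner_def)
  then show "Transposition.transpose (2 * x) (2 * x + 1) n = swap (\<lambda>i. i = pair_index x) n"
    by (auto simp: swap_def Transposition.transpose_def partner_def)
qed

text \<open>
  The permutation \<open>g\<close> respects the partition into cells and induces \<open>\<sigma>\<close> on the cells.
\<close>

definition covers :: "(nat \<Rightarrow> nat) \<Rightarrow> (int \<Rightarrow> int) \<Rightarrow> bool" where
  "covers g \<sigma> \<longleftrightarrow> bij g \<and> (\<forall>n. cell (g n) = \<sigma> (cell n))"

lemma covers_in_SymN: "covers g \<sigma> \<Longrightarrow> g \<in> carrier SymN"
  by (simp add: covers_def carrier_SymN)

text \<open>
  Injectivity of \<open>g\<close> forces the second point of a cell to go to the only place left in the image cell.
\<close>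

lemma covers_partner:
  assumes "covers g \<sigma>"
  shows "g (partner n) = partner (g n)"
proof -
  have "cell (g (partner n)) = cell (g n)"
    using assms by (simp add: covers_def)
  moreover have "g (partner n) \<noteq> g n"
    using assms partner_neq[of n] by (auto simp: covers_def inj_eq[OF bij_is_inj])
  ultimately show ?thesis by (simp add: cell_eq_iff)
qed

lemma swap_covers:
  assumes "covers g \<sigma>"
  shows "swap u \<circ> g = g \<circ> swap (u \<circ> \<sigma>)"
  using assms covers_partner[OF assms] by (auto simp: fun_eq_iff swap_def covers_def)

text \<open>
  Conjugation by \<open>g\<close> turns \<open>u\<close> into \<open>u \<circ> \<sigma>\<close>, and swaps are involutions that multiply by adding the
  functions modulo 2. That is why both orders of the commutator give the same result.
\<close>

lemma commutator_covers:
  assumes g: "covers g \<sigma>"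
  shows "commutator SymN g (swap u) = swap (\<lambda>i. u i \<noteq> u (\<sigma> i))" (is ?A)
    and "commutator SymN (swap u) g = swap (\<lambda>i. u i \<noteq> u (\<sigma> i))" (is ?B)
proof -
  let ?w = "\<lambda>i. u i \<noteq> u (\<sigma> i)"
  have bij: "bij g" using g by (simp add: covers_def)
  have "swap (u \<circ> \<sigma>) \<circ> swap ?w = swap u" "swap u \<circ> swap ?w = swap (u \<circ> \<sigma>)"
    by (auto simp: swap_swap swap_eq_iff)
  then have "g \<circ> swap u = (swap u \<circ> g) \<circ> swap ?w" "swap u \<circ> g = (g \<circ> swap u) \<circ> swap ?w"
    by (simp_all add: swap_covers[OF g] comp_assoc)
  then show ?A ?B
    using covers_in_SymN[OF g]
    by (simp_all add: SymN.commutator_eq_iff mult_SymN bij bij_swap bij_comp)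
qed

lemma covers_swap: "covers (swap u) (\<lambda>i. i)"
  by (simp add: covers_def bij_swap)

lemma covers_shift_hat: "covers shift_hat (\<lambda>i. i + 1)"
  by (simp add: covers_def bij_shift_hat cell_shift_hat)

lemma covers_id_imp_swap:
  assumes x: "covers x (\<lambda>i. i)"
  shows "\<exists>u. x = swap u"
proof
  \<comment> \<open>\<open>x\<close> moves either both points of a cell or neither, so any point of the cell decides.\<close>
  let ?u = "\<lambda>i. \<exists>n. cell n = i \<and> x n \<noteq> n"
  show "x = swap ?u"
  proof
    fix n
    have "x n = n \<or> x n = partner n"
      using x by (simp add: covers_def flip: cell_eq_iff)
    moreover have "?u (cell n) \<longleftrightarrow> x n \<noteq> n"
      using covers_partner[OF x, of n] by (auto simp: cell_eq_iff)
    ultimately show "x n = swap ?u n" by (auto simp: swap_def)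
  qed
qed

section \<open>The difference operator\<close>

definition fdiff :: "(int \<Rightarrow> bool) \<Rightarrow> int \<Rightarrow> bool" where
  "fdiff u i \<longleftrightarrow> (u i \<noteq> u (i + 1))"

lemma fdiff_funpow_add:
  "(fdiff ^^ k) (\<lambda>i. u i \<noteq> v i) = (\<lambda>i. (fdiff ^^ k) u i \<noteq> (fdiff ^^ k) v i)"
  by (induction k arbitrary: u v) (auto simp: fdiff_def fun_eq_iff)

lemma fdiff_funpow_translate:
  "(fdiff ^^ k) (\<lambda>i. u (i + d)) = (\<lambda>i. (fdiff ^^ k) u (i + d))"
  by (induction k) (auto simp: fdiff_def fun_eq_iff add_ac)

lemma fdiff_funpow_zero: "(fdiff ^^ k) (\<lambda>_. False) = (\<lambda>_. False)"
  by (induction k) (auto simp: fdiff_def fun_eq_iff)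

text \<open>
  This is the identity \<open>(1 + t)\<^sup>q = 1 + t\<^sup>q\<close> for a power \<open>q\<close> of two in characteristic two, with
  \<open>t\<close> the translation by one.
\<close>

lemma fdiff_funpow_power2: "(fdiff ^^ (2 ^ m)) u i \<longleftrightarrow> (u i \<noteq> u (i + 2 ^ m))"
proof (induction m arbitrary: u i)
  case 0
  then show ?case by (simp add: fdiff_def)
next
  case (Suc m)
  have "(fdiff ^^ (2 ^ Suc m)) u i = (fdiff ^^ (2 ^ m)) ((fdiff ^^ (2 ^ m)) u) i"
    by (simp add: mult_2 funpow_add)
  also have "\<dots> \<longleftrightarrow> (u i \<noteq> u (i + 2 ^ Suc m))"
    unfolding Suc.IH by (auto simp: algebra_simps)
  finally show ?case .
qed

lemma fdiff_eq_zero_imp_const: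
  assumes "fdiff u = (\<lambda>_. False)"
  shows "u i = u j"
proof -
  have step: "u (i + 1) = u i" for i
    using fun_cong[OF assms, of i] by (auto simp: fdiff_def)
  have "u i = u 0" for i
  proof (induction i rule: int_induct[where k = 0])
    case (step2 i)
    then show ?case using step[of "i - 1"] by simp
  qed (simp_all add: step)
  then show ?thesis by metis
qed

text \<open>
  A function killed by \<open>fdiff\<close> is constant, and the only constant of finite support on the integers is
  zero. So \<open>fdiff\<close> is injective on functions of finite support, which it preserves.
\<close>

lemma fdiff_funpow_finite_support:
  assumes "(fdiff ^^ k) u = (\<lambda>_. False)" "finite {i. u i}"
  shows "u = (\<lambda>_. False)"
  using assms
proof (induction k arbitrary: u)
  case (Suc k)
  have "{i. fdiff u i} \<subseteq> {i. u i} \<union> (\<lambda>i. i - 1) ` {i. u i}"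
    by (force simp: fdiff_def image_iff)
  then have "finite {i. fdiff u i}"
    using Suc.prems(2) by (meson finite_UnI finite_imageI finite_subset)
  with Suc have "fdiff u = (\<lambda>_. False)" by (simp add: funpow_swap1)
  then have const: "u i = u j" for i j by (rule fdiff_eq_zero_imp_const)
  show ?case
  proof
    fix i
    have "{i. u i} = UNIV" if "u i" using that const by blast
    then show "u i = False" using Suc.prems(2) infinite_UNIV_int by metis
  qed
qed simp

text \<open>
  A translation acts trivially on each quotient of consecutive kernels of the powers of \<open>fdiff\<close>, because
  \<open>fdiff ^^ k\<close> maps the next kernel to constants.
\<close>

lemma fdiff_funpow_Suc_translate:
  assumes "(fdiff ^^ Suc k) u = (\<lambda>_. False)"
  shows "(fdiff ^^ k) (\<lambda>i. u i \<noteq> u (i + d)) = (\<lambda>_. False)"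
proof -
  have "fdiff ((fdiff ^^ k) u) = (\<lambda>_. False)" using assms by simp
  then have "(fdiff ^^ k) u i = (fdiff ^^ k) u (i + d)" for i by (rule fdiff_eq_zero_imp_const)
  then show ?thesis
    unfolding fdiff_funpow_add fdiff_funpow_translate[of k u d] by blast
qed

section \<open>The iterated centralizers\<close>

text \<open>
  Over the field with two elements, the functions killed by \<open>fdiff ^^ k\<close> are the integer-valued
  polynomials of degree less than \<open>k\<close> reduced modulo 2.
\<close>

definition poly_swaps :: "nat \<Rightarrow> (nat \<Rightarrow> nat) set" where
  "poly_swaps k = {swap u | u. (fdiff ^^ k) u = (\<lambda>_. False)}"

lemma swap_in_poly_swaps: "swap u \<in> poly_swaps k \<longleftrightarrow> (fdiff ^^ k) u = (\<lambda>_. False)"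
  by (auto simp: poly_swaps_def swap_eq_iff)

lemma poly_swaps_Suc: "poly_swaps k \<subseteq> poly_swaps (Suc k)"
proof -
  have "fdiff (\<lambda>_. False) = (\<lambda>_. False)" by (auto simp: fdiff_def)
  then show ?thesis by (auto simp: poly_swaps_def swap_eq_iff)
qed

lemma poly_swaps_subgroup: "subgroup (poly_swaps k) SymN"
proof (rule SymN.subgroupI)
  show "poly_swaps k \<noteq> {}"
    using fdiff_funpow_zero by (auto simp: poly_swaps_def)
  fix a b assume "a \<in> poly_swaps k" "b \<in> poly_swaps k"
  then obtain u v where ab: "a = swap u" "(fdiff ^^ k) u = (\<lambda>_. False)"
      "b = swap v" "(fdiff ^^ k) v = (\<lambda>_. False)"
    by (auto simp: poly_swaps_def)
  show "a \<otimes>\<^bsub>SymN\<^esub> b \<in> poly_swaps k"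
    unfolding ab(1,3) mult_swap swap_in_poly_swaps fdiff_funpow_add ab(2,4) by simp
qed (auto simp: poly_swaps_def)

lemma transpose_in_H: "Transposition.transpose (2 * x) (2 * x + 1) \<in> H_sub"
  unfolding H_sub_def K_sub_def by (intro generate.incl UnI1) blast

lemma shift_hat_in_H: "shift_hat \<in> H_sub"
  unfolding H_sub_def by (auto intro: generate.incl)

text \<open>
  This subgroup contains the generators of \<open>H\<close>; it serves to see that every element of \<open>H\<close> acts on
  the cells by a translation.
\<close>

lemma translations_subgroup: "subgroup {h. \<exists>d. covers h (\<lambda>i. i + d)} SymN"
proof (rule SymN.subgroupI)
  show "{h. \<exists>d. covers h (\<lambda>i. i + d)} \<noteq> {}" using covers_shift_hat by blast
  fix a assume "a \<in> {h. \<exists>d. covers h (\<lambda>i. i + d)}"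
  then obtain d where a: "covers a (\<lambda>i. i + d)" by blast
  let ?b = "inv\<^bsub>SymN\<^esub> a"
  have b: "bij ?b" using a covers_in_SymN carrier_SymN by (metis SymN.inv_closed mem_Collect_eq)
  have "a \<circ> ?b = id"
    using SymN.r_inv[OF covers_in_SymN[OF a]] a b
    by (simp add: mult_SymN covers_def one_SymN swap_False)
  then have "cell (?b n) = cell n - d" for n
    using a by (metis covers_def comp_apply id_apply add_diff_cancel_right')
  then have "covers ?b (\<lambda>i. i + - d)"
    using b by (simp add: covers_def)
  then show "?b \<in> {h. \<exists>d. covers h (\<lambda>i. i + d)}" by blast
  fix c assume "c \<in> {h. \<exists>d. covers h (\<lambda>i. i + d)}"
  then obtain e where "covers c (\<lambda>i. i + e)" by blast
  with a have "covers (a \<otimes>\<^bsub>SymN\<^esub> c) (\<lambda>i. i + (e + d))"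
    by (simp add: covers_def mult_SymN bij_comp)
  then show "a \<otimes>\<^bsub>SymN\<^esub> c \<in> {h. \<exists>d. covers h (\<lambda>i. i + d)}" by blast
qed (auto intro: covers_in_SymN)

lemma H_sub_least:
  assumes "subgroup E SymN" "range swap \<subseteq> E" "shift_hat \<in> E"
  shows "H_sub \<subseteq> E"
proof -
  have "K_sub \<subseteq> E"
    unfolding K_sub_def using assms(1,2)
    by (intro SymN.generate_subgroup_incl) (auto simp only: transpose_eq_swap)
  with assms show ?thesis
    unfolding H_sub_def by (intro SymN.generate_subgroup_incl) auto
qed

lemma H_sub_translation:
  assumes "h \<in> H_sub"
  shows "\<exists>d. covers h (\<lambda>i. i + d)"
proof -
  have "covers (swap u) (\<lambda>i. i + 0)" for u using covers_swap by simp
  then have "range swap \<subseteq> {h. \<exists>d. covers h (\<lambda>i. i + d)}" by blast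
  moreover have "shift_hat \<in> {h. \<exists>d. covers h (\<lambda>i. i + d)}" using covers_shift_hat by blast
  ultimately show ?thesis
    using H_sub_least[OF translations_subgroup] assms by blast
qed

text \<open>
  The commutator moves a point only if the point or its image under \<open>x\<close> is moved by \<open>t\<close>, up to
  passing to the partner. So its support is finite, and a swap of finite support in \<open>poly_swaps k\<close> is
  trivial.
\<close>

lemma commutator_transpose_poly_swap:
  assumes x: "bij x" and c: "commutator SymN x t \<in> poly_swaps k"
    and t: "t = Transposition.transpose (2 * i) (2 * i + 1)"
  shows "x \<circ> t = t \<circ> x"
proof -
  obtain w where w: "commutator SymN x t = swap w" "(fdiff ^^ k) w = (\<lambda>_. False)"
    using c by (auto simp: poly_swaps_def)
  have bt: "bij t" unfolding t by simp
  have eq: "x \<circ> t = t \<circ> x \<circ> swap w"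
    using w(1) SymN.commutator_eq_iff[of x t "swap w"] x bt bij_swap[of w]
    by (simp add: carrier_SymN mult_SymN bij_comp)
  let ?P = "{2 * i, 2 * i + 1}"
  have t_fixed: "t n = n" if "n \<notin> ?P" for n
    using that by (auto simp: t Transposition.transpose_def)
  have "{j. w j} \<subseteq> cell ` (?P \<union> x -` ?P)"
  proof
    fix j assume "j \<in> {j. w j}"
    obtain n where n: "cell n = j" using cell_surj by blast
    with \<open>j \<in> {j. w j}\<close> have moved: "swap w n = partner n" by (simp add: swap_def)
    have "n \<in> ?P \<union> x -` ?P \<or> partner n \<in> ?P \<union> x -` ?P"
    proof (rule ccontr)
      assume "\<not> ?thesis"
      then have "t n = n" "t (x (partner n)) = x (partner n)" by (auto intro!: t_fixed)
      then have "x n = x (partner n)"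
        using fun_cong[OF eq, of n] moved by simp
      then show False using x partner_neq[of n] by (auto simp: inj_eq[OF bij_is_inj])
    qed
    then show "j \<in> cell ` (?P \<union> x -` ?P)"
      using n cell_partner[of n] by (metis image_eqI)
  qed
  moreover have "finite (x -` ?P)"
    using x by (intro finite_vimageI) (auto simp: bij_is_inj)
  ultimately have "finite {j. w j}"
    by (meson finite_UnI finite_imageI finite_subset finite.intros)
  with w(2) have "w = (\<lambda>_. False)" by (rule fdiff_funpow_finite_support)
  with eq show ?thesis by (simp add: swap_False)
qed

text \<open>
  If \<open>x n\<close> left the cell of \<open>n\<close>, the transposition of that cell would fix \<open>x n\<close> but move \<open>n\<close>.
\<close>

lemma centralizes_transposes_imp_swap:
  assumes x: "bij x"
    and comm: "\<And>i. x \<circ> Transposition.transpose (2 * i) (2 * i + 1)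
                  = Transposition.transpose (2 * i) (2 * i + 1) \<circ> x"
  shows "\<exists>u. x = swap u"
proof -
  have "cell (x n) = cell n" for n
  proof (rule ccontr)
    let ?i = "n div 2"
    let ?t = "Transposition.transpose (2 * ?i) (2 * ?i + 1)"
    assume "cell (x n) \<noteq> cell n"
    then have "?t (x n) = x n" "?t n = partner n"
      unfolding transpose_eq_swap swap_def by (simp_all flip: cell_def)
    then have "x (partner n) = x n"
      using fun_cong[OF comm[of ?i], of n] by simp
    then show False using x partner_neq[of n] by (auto simp: inj_eq[OF bij_is_inj])
  qed
  with x show ?thesis by (intro covers_id_imp_swap) (simp add: covers_def)
qed

text \<open>
  The ambient group \<open>E\<close> is kept general because the iterated centralizers in the definition of the
  envelopes are taken in a different group at each step. The normalizer conditions hold for all swaps,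
  which commute with each other; the condition on commutators with the transpositions forces \<open>x\<close>
  to be a swap, and the one on the commutator with \<open>shift_hat\<close> then gives the equation for the
  difference operator.
\<close>

lemma iterated_centralizer_eq:
  assumes E: "subgroup E SymN" "range swap \<subseteq> E" "shift_hat \<in> E"
  shows "iterated_centralizer (SymN\<lparr>carrier := E\<rparr>) H_sub k = poly_swaps k"
proof (induction k rule: less_induct)
  case (less k)
  let ?E = "SymN\<lparr>carrier := E\<rparr>"
  interpret E: group ?E by (rule SymN.subgroup_imp_group[OF E(1)])
  have HE: "H_sub \<subseteq> E" by (rule H_sub_least[OF E])
  show ?case
  proof (cases k)
    case 0
    then show ?thesis by (simp add: poly_swaps_def one_SymN)
  next
    case (Suc l)
    have IH: "iterated_centralizer ?E H_sub n = poly_swaps n" if "n \<le> l" for n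
      using less Suc that by simp
    have comm: "commutator ?E x h = commutator SymN x h" if "x \<in> E" "h \<in> H_sub" for x h
      using that HE by (auto intro: SymN.commutator_subgroup[OF E(1)])
    have C: "iterated_centralizer ?E H_sub k =
      {x \<in> (\<Inter>n\<in>{..l}. normalizer ?E (poly_swaps n)). commutator_set ?E x H_sub \<subseteq> poly_swaps l}"
      unfolding Suc iterated_centralizer.simps using IH by simp
    show ?thesis unfolding C
    proof (intro equalityI subsetI)
      fix x
      assume x: "x \<in> {x \<in> (\<Inter>n\<in>{..l}. normalizer ?E (poly_swaps n)).
        commutator_set ?E x H_sub \<subseteq> poly_swaps l}"
      then have xE: "x \<in> E" using normalizer_subset by fastforce
      then have bx: "bij x"
        using subgroup.mem_carrier[OF E(1)] by (simp add: carrier_SymN)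
      have c: "commutator SymN x h \<in> poly_swaps l" if "h \<in> H_sub" for h
        using x that comm[OF xE that] by (auto simp: commutator_set_def)
      obtain u where u: "x = swap u"
        using centralizes_transposes_imp_swap[OF bx]
          commutator_transpose_poly_swap[OF bx c[OF transpose_in_H] refl] by blast
      have "swap (\<lambda>i. u i \<noteq> u (i + 1)) \<in> poly_swaps l"
        using c[OF shift_hat_in_H] by (simp add: u commutator_covers[OF covers_shift_hat])
      then have "swap (fdiff u) \<in> poly_swaps l" by (simp add: fdiff_def[abs_def])
      then show "x \<in> poly_swaps k"
        by (simp add: u Suc swap_in_poly_swaps funpow_swap1)
    next
      fix x assume "x \<in> poly_swaps k"
      then obtain u where u: "x = swap u" "(fdiff ^^ Suc l) u = (\<lambda>_. False)"
        by (auto simp: poly_swaps_def Suc)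
      have xE: "x \<in> E" using E(2) u(1) by blast
      have "x \<in> normalizer ?E (poly_swaps n)" for n
        using E(2) xE
        by (intro E.commuting_in_normalizer) (auto simp: poly_swaps_def u(1) swap_eq_iff)
      moreover have "commutator ?E x h \<in> poly_swaps l" if h: "h \<in> H_sub" for h
      proof -
        obtain d where d: "covers h (\<lambda>i. i + d)" using H_sub_translation[OF h] by blast
        show ?thesis
          unfolding comm[OF xE h] unfolding u(1) commutator_covers[OF d] swap_in_poly_swaps
          by (rule fdiff_funpow_Suc_translate[OF u(2)])
      qed
      ultimately show "x \<in> {x \<in> (\<Inter>n\<in>{..l}. normalizer ?E (poly_swaps n)).
        commutator_set ?E x H_sub \<subseteq> poly_swaps l}"
        by (auto simp: commutator_set_def)
    qed
  qed
qed

section \<open>The envelopes\<close>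

lemma envelope_Suc_eq:
  assumes "subgroup (envelope SymN H_sub k) SymN" "range swap \<subseteq> envelope SymN H_sub k"
    "shift_hat \<in> envelope SymN H_sub k"
  shows "envelope SymN H_sub (Suc k) =
    {g \<in> envelope SymN H_sub k. \<forall>x\<in>poly_swaps (Suc k). commutator SymN g x \<in> poly_swaps k}"
  unfolding envelope.simps iterated_centralizer_eq[OF assms]
  by (auto simp: commutator_set_def)

text \<open>
  These elements commute with \<open>L\<close> modulo \<open>M\<close>. The identities for the commutators of products and
  inverses involve conjugates of elements of \<open>M\<close>, so \<open>M\<close> has to be invariant under \<open>E\<close>.
  The subgroup \<open>E\<close> and its successor in the chain of envelopes are related in this way.
\<close>

lemma (in group) unitriangular_subgroup:
  assumes E: "subgroup E G" and M: "subgroup M G" and L: "L \<subseteq> carrier G"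
    and norm: "\<And>g x. g \<in> E \<Longrightarrow> x \<in> M \<Longrightarrow> inv g \<otimes> x \<otimes> g \<in> M"
  shows "subgroup {g \<in> E. \<forall>x\<in>L. commutator G g x \<in> M} G"
proof (rule subgroupI)
  have Ec: "g \<in> carrier G" if "g \<in> E" for g using subgroup.mem_carrier[OF E that] .
  show "{g \<in> E. \<forall>x\<in>L. commutator G g x \<in> M} \<subseteq> carrier G" using Ec by blast
  have "commutator G \<one> x = \<one>" if "x \<in> L" for x
    using L that by (simp add: commutator_def subset_iff)
  then have "\<one> \<in> {g \<in> E. \<forall>x\<in>L. commutator G g x \<in> M}"
    using subgroup.one_closed[OF E] subgroup.one_closed[OF M] by simp
  then show "{g \<in> E. \<forall>x\<in>L. commutator G g x \<in> M} \<noteq> {}" by blast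
  fix a assume a: "a \<in> {g \<in> E. \<forall>x\<in>L. commutator G g x \<in> M}"
  have "commutator G (inv a) x \<in> M" if "x \<in> L" for x
    using norm[of "inv a" "inv (commutator G a x)"] a that L Ec
      subgroup.m_inv_closed[OF E, of a] subgroup.m_inv_closed[OF M]
    by (auto simp: commutator_inv_left subset_iff)
  then show "inv a \<in> {g \<in> E. \<forall>x\<in>L. commutator G g x \<in> M}"
    using a subgroup.m_inv_closed[OF E] by blast
  fix b assume b: "b \<in> {g \<in> E. \<forall>x\<in>L. commutator G g x \<in> M}"
  have "commutator G (a \<otimes> b) x \<in> M" if "x \<in> L" for x
    using norm[of b "commutator G a x"] a b that L Ec subgroup.m_closed[OF M]
    by (auto simp: commutator_mult_left subset_iff)
  then show "a \<otimes> b \<in> {g \<in> E. \<forall>x\<in>L. commutator G g x \<in> M}"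
    using a b subgroup.m_closed[OF E] by blast
qed

text \<open>
  The first three properties allow the iterated centralizers in \<open>E\<^sub>k(H)\<close> to be computed; the last one,
  invariance of \<open>poly_swaps k\<close> under conjugation, makes \<open>E\<^sub>k\<^sub>+\<^sub>1(H)\<close> a subgroup again. They depend on
  each other and are proved by a joint induction.
\<close>

lemma envelope_invariants:
  "subgroup (envelope SymN H_sub k) SymN \<and> range swap \<subseteq> envelope SymN H_sub k
    \<and> shift_hat \<in> envelope SymN H_sub k
    \<and> (\<forall>g\<in>envelope SymN H_sub k. \<forall>x\<in>poly_swaps k. inv\<^bsub>SymN\<^esub> g \<otimes>\<^bsub>SymN\<^esub> x \<otimes>\<^bsub>SymN\<^esub> g \<in> poly_swaps k)"
proof (induction k)
  case 0
  have "inv\<^bsub>SymN\<^esub> g \<otimes>\<^bsub>SymN\<^esub> x \<otimes>\<^bsub>SymN\<^esub> g \<in> poly_swaps 0"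
    if "g \<in> carrier SymN" "x \<in> poly_swaps 0" for g x
  proof -
    have zero: "poly_swaps 0 = {\<one>\<^bsub>SymN\<^esub>}" by (simp add: poly_swaps_def one_SymN)
    from that show ?thesis unfolding zero by simp
  qed
  then show ?case
    using SymN.subgroup_self bij_shift_hat bij_swap by (auto simp: carrier_SymN)
next
  case (Suc k)
  let ?E = "envelope SymN H_sub"
  have sub: "subgroup (?E k) SymN" "range swap \<subseteq> ?E k" "shift_hat \<in> ?E k"
    using Suc by blast+
  have eq: "?E (Suc k) = {g \<in> ?E k. \<forall>x\<in>poly_swaps (Suc k). commutator SymN g x \<in> poly_swaps k}"
    by (rule envelope_Suc_eq[OF sub])
  have carr: "poly_swaps (Suc k) \<subseteq> carrier SymN"
    by (rule subgroup.subset[OF poly_swaps_subgroup])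
  have "subgroup (?E (Suc k)) SymN"
    unfolding eq using Suc carr
    by (intro SymN.unitriangular_subgroup[OF sub(1) poly_swaps_subgroup]) auto
  moreover have "range swap \<subseteq> ?E (Suc k)"
    unfolding eq using sub(2)
    by (auto simp: poly_swaps_def commutator_covers[OF covers_swap] swap_eq_iff fdiff_funpow_zero)
  moreover have "shift_hat \<in> ?E (Suc k)"
  proof -
    have "commutator SymN shift_hat x \<in> poly_swaps k" if x: "x \<in> poly_swaps (Suc k)" for x
    proof -
      obtain u where u: "x = swap u" "(fdiff ^^ Suc k) u = (\<lambda>_. False)"
        using x by (auto simp: poly_swaps_def)
      show ?thesis
        unfolding u(1) commutator_covers[OF covers_shift_hat] swap_in_poly_swaps
        by (rule fdiff_funpow_Suc_translate[OF u(2)])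
    qed
    then show ?thesis unfolding eq using sub(3) by blast
  qed
  moreover have "inv\<^bsub>SymN\<^esub> g \<otimes>\<^bsub>SymN\<^esub> x \<otimes>\<^bsub>SymN\<^esub> g \<in> poly_swaps (Suc k)"
    if g: "g \<in> ?E (Suc k)" and x: "x \<in> poly_swaps (Suc k)" for g x
  proof -
    have "commutator SymN g x \<in> poly_swaps (Suc k)"
      using g x poly_swaps_Suc unfolding eq by blast
    moreover have "g \<in> carrier SymN"
      using g subgroup.mem_carrier[OF sub(1)] unfolding eq by blast
    ultimately show ?thesis
      using x carr poly_swaps_subgroup[of "Suc k"]
      by (simp add: SymN.conjugate_eq_commutator subset_iff subgroup.m_closed subgroup.m_inv_closed)
  qed
  ultimately show ?case by blast
qed

lemma envelope_subgroup: "subgroup (envelope SymN H_sub k) SymN"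
  using envelope_invariants by blast

lemma envelope_Suc:
  "envelope SymN H_sub (Suc k) =
    {g \<in> envelope SymN H_sub k. \<forall>x\<in>poly_swaps (Suc k). commutator SymN g x \<in> poly_swaps k}"
  by (intro envelope_Suc_eq) (use envelope_invariants in blast)+

lemma envelope_antimono: "j \<le> k \<Longrightarrow> envelope SymN H_sub k \<subseteq> envelope SymN H_sub j"
  by (rule lift_Suc_antimono_le) auto

section \<open>Separating the envelopes\<close>

lemma ex_covers_transpose: "\<exists>g. covers g (Transposition.transpose a b)"
proof -
  obtain p q where pq: "pair_index p = a" "pair_index q = b" using pair_index_surj by metis
  let ?\<tau> = "Transposition.transpose p q"
  let ?g = "\<lambda>n. 2 * ?\<tau> (n div 2) + n mod 2"
  have "?g \<circ> ?g = id" by (auto simp: fun_eq_iff)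
  then have "bij ?g" by (rule o_bij[of ?g]) fact
  moreover have "cell (?g n) = Transposition.transpose a b (cell n)" for n
    using inj_eq[OF inj_pair_index] by (auto simp: cell_def Transposition.transpose_def simp flip: pq)
  ultimately show ?thesis by (auto simp: covers_def)
qed

lemma poly_swaps_periodic:
  assumes "swap u \<in> poly_swaps k" "k \<le> 2 ^ m"
  shows "u (i + 2 ^ m) = u i"
proof -
  have "(fdiff ^^ (2 ^ m)) u = (fdiff ^^ (2 ^ m - k)) ((fdiff ^^ k) u)"
    using assms(2) by (metis funpow_add comp_apply le_add_diff_inverse2)
  then have "(fdiff ^^ (2 ^ m)) u = (\<lambda>_. False)"
    using assms(1) by (simp add: swap_in_poly_swaps fdiff_funpow_zero)
  then show ?thesis using fdiff_funpow_power2[of m u i] by simp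
qed

text \<open>
  Functions of period \<open>2 ^ m\<close> do not see the exchange of the cells \<open>0\<close> and \<open>2 ^ m\<close>, so the
  commutators in question are trivial.
\<close>

lemma cell_exchange_in_envelope:
  assumes g: "covers g (Transposition.transpose 0 (2 ^ m))"
  shows "k \<le> 2 ^ m \<Longrightarrow> g \<in> envelope SymN H_sub k"
proof (induction k)
  case 0
  then show ?case using covers_in_SymN[OF g] by simp
next
  case (Suc k)
  have "commutator SymN g x \<in> poly_swaps k" if x: "x \<in> poly_swaps (Suc k)" for x
  proof -
    obtain u where u: "x = swap u" using x by (auto simp: poly_swaps_def)
    have "u (2 ^ m) = u 0"
      using poly_swaps_periodic[of u "Suc k" m 0] x u Suc.prems by simp
    then have "u i = u (Transposition.transpose 0 (2 ^ m) i)" for i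
      by (simp add: Transposition.transpose_def)
    then show ?thesis
      by (simp add: u commutator_covers[OF g] swap_in_poly_swaps fdiff_funpow_zero)
  qed
  with Suc show ?case by (simp add: envelope_Suc del: envelope.simps)
qed

text \<open>
  The indicator function of the multiples of \<open>2 ^ Suc m\<close> separates the cells \<open>0\<close> and \<open>2 ^ m\<close>, and
  the resulting commutator is a nontrivial swap of finite support.
\<close>

lemma cell_exchange_not_in_envelope:
  assumes g: "covers g (Transposition.transpose 0 (2 ^ m))"
  shows "g \<notin> envelope SymN H_sub (2 ^ Suc m)"
proof
  assume mem: "g \<in> envelope SymN H_sub (2 ^ Suc m)"
  obtain l where l: "(2::nat) ^ Suc m = Suc l" by (metis not0_implies_Suc power_not_zero zero_neq_numeral)
  define u :: "int \<Rightarrow> bool" where "u i \<longleftrightarrow> 2 ^ Suc m dvd i" for i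
  let ?w = "\<lambda>i. u i \<noteq> u (Transposition.transpose 0 (2 ^ m) i)"
  have "(fdiff ^^ (2 ^ Suc m)) u = (\<lambda>_. False)"
    by (rule ext, subst fdiff_funpow_power2) (simp add: u_def)
  then have "swap u \<in> poly_swaps (Suc l)"
    by (simp only: swap_in_poly_swaps l)
  with mem have "swap ?w \<in> poly_swaps l"
    unfolding l envelope_Suc commutator_covers(1)[OF g, symmetric] by blast
  then have "(fdiff ^^ l) ?w = (\<lambda>_. False)" by (simp only: swap_in_poly_swaps)
  moreover have "finite {i. ?w i}"
    by (rule finite_subset[of _ "{0, 2 ^ m}"]) (auto simp: Transposition.transpose_def split: if_splits)
  ultimately have "?w = (\<lambda>_. False)" by (rule fdiff_funpow_finite_support)
  then have "u 0 = u (2 ^ m)" by (metis Transposition.transpose_apply_first)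
  then have "(2::int) ^ Suc m dvd 2 ^ m" by (simp add: u_def)
  then show False using zdvd_imp_le by force
qed

theorem theorem2:
  shows "\<forall>k. \<exists>k'>k.
    subgroup (envelope SymN H_sub (k' + 1)) (SymN\<lparr>carrier := envelope SymN H_sub (k + 1)\<rparr>)
    \<and> envelope SymN H_sub (k' + 1) \<noteq> envelope SymN H_sub (k + 1)"
proof
  fix k :: nat
  define m where "m = Suc k"
  define k' :: nat where "k' = 2 ^ Suc m - 1"
  obtain g where g: "covers g (Transposition.transpose 0 (2 ^ m))"
    using ex_covers_transpose by blast
  have le: "k + 1 \<le> 2 ^ m" using less_exp[of m] by (simp add: m_def)
  have k': "k' + 1 = 2 ^ Suc m" by (simp add: k'_def)
  have "k < k'" using le k' by simp
  moreover have "g \<in> envelope SymN H_sub (k + 1)" "g \<notin> envelope SymN H_sub (k' + 1)"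
    using cell_exchange_in_envelope[OF g le] cell_exchange_not_in_envelope[OF g] k' by metis+
  moreover have "subgroup (envelope SymN H_sub (k' + 1))
      (SymN\<lparr>carrier := envelope SymN H_sub (k + 1)\<rparr>)"
    using \<open>k < k'\<close> by (intro SymN.subgroup_incl envelope_subgroup envelope_antimono) simp
  ultimately show "\<exists>k'>k.
    subgroup (envelope SymN H_sub (k' + 1)) (SymN\<lparr>carrier := envelope SymN H_sub (k + 1)\<rparr>)
    \<and> envelope SymN H_sub (k' + 1) \<noteq> envelope SymN H_sub (k + 1)"
    by blast
qed

end
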